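(* Fix an iteration $t\ge1$ and assume that for each $\mathbf{x}\in\mathcal{D}_{\mathbf{x}}$ the functions $u_{t-1}(\mathbf{x},\cdot)$ and $l_{t-1}(\mathbf{x},\cdot)$ attain their minima over $\mathcal{D}_{\mathbf{z}}$. Then StableOpt (for the adversarially robust problem $\max_{\mathbf{x}}\min_{\mathbf{z}} f(\mathbf{x},\mathbf{z})$) and V-UCB in the limit $\alpha\to0^+$ (for the problem $\max_{\mathbf{x}}\lim_{\alpha\to0^+}V_\alpha(f(\mathbf{x},\mathbf{Z}))$, where $\mathbf{Z}$ has support $\mathcal{D}_{\mathbf{z}}$) select the same input queries. That is: (i) $\arg\max_{\mathbf{x}\in\mathcal{D}_{\mathbf{x}}}\lim_{\alpha\to0^+}V_\alpha(u_{t-1}(\mathbf{x},\mathbf{Z})) = \arg\max_{\mathbf{x}\in\mathcal{D}_{\mathbf{x}}}\min_{\mathbf{z}\in\mathcal{D}_{\mathbf{z}}}u_{t-1}(\mathbf{x},\mathbf{z})$; and (ii) for the selected $\mathbf{x}_t$, the set of lacing values in the limit $\alpha\to0^+$, $$\Big\{\mathbf{z}\in\mathcal{D}_{\mathbf{z}} : l_{t-1}(\mathbf{x}_t,\mathbf{z})\le \lim_{\alpha\to0^+}V_\alpha(l_{t-1}(\mathbf{x}_t,\mathbf{Z})) \text{ and } u_{t-1}(\mathbf{x}_t,\mathbf{z})\ge\lim_{\alpha\to0^+}V_\alpha(u_{t-1}(\mathbf{x}_t,\mathbf{Z}))\Big\},$$ equals $\arg\min_{\mathbf{z}\in\mathcal{D}_{\mathbf{z}}}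 l_{t-1}(\mathbf{x}_t,\mathbf{z})$.
   Context: Domains. $\mathcal{D}_{\mathbf{x}} \subset \mathbb{R}^{d_x}$ is a bounded set. $\mathbf{Z}$ is a random variable in $\mathbb{R}^{d_z}$ and $\mathcal{D}_{\mathbf{z}}$ is its support, i.e. the smallest closed subset of $\mathbb{R}^{d_z}$ with $P(\mathbf{Z} \in \mathcal{D}_{\mathbf{z}})=1$. $f:\mathcal{D}_{\mathbf{x}}\times\mathcal{D}_{\mathbf{z}}\to\mathbb{R}$ is the objective. Value-at-risk. For a real random variable $Y$ and $\alpha\in(0,1)$, $V_\alpha(Y) := \inf\{\omega \in \mathbb{R} : P(Y \le \omega) \ge \alpha\}$. For $g:\mathcal{D}_{\mathbf{x}}\times\mathcal{D}_{\mathbf{z}}\to\mathbb{R}$ and fixed $\mathbf{x}$, $g(\mathbf{x},\mathbf{Z})$ is the real random variable whose randomness comes only from $\mathbf{Z}$ (the observations determining $l_{t-1},u_{t-1}$ are held fixed). Confidence bounds. $l_{t-1} := \mu_{t-1} - \beta_t^{1/2}\sigma_{t-1}$ and $u_{t-1} := \mu_{t-1} + \beta_t^{1/2}\sigma_{t-1}$ with $\beta_t\ge0$, where $\mu_{t-1}$ and $\sigma_{t-1}$ are the Gaussian process posterior mean and standard deviation given finitely many observations $\mathbf{y}_{\mathcal{D}_{t-1}}$ at inputs $\mathcal{D}_{t-1}\subset\mathcal{D}_{\mathbf{x}}\times\mathcal{D}_{\mathbf{z}}$, with zero prior mean, squared exponential kernel $k$ and noise variance $\sigma_n^2>0$: $\mu_{t-1}(\mathbf{x},\mathbf{z})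 = \mathbf{K}_{(\mathbf{x},\mathbf{z}),\mathcal{D}_{t-1}}(\mathbf{K}_{\mathcal{D}_{t-1}\mathcal{D}_{t-1}}+\sigma_n^2\mathbf{I})^{-1}\mathbf{y}_{\mathcal{D}_{t-1}}$, $\sigma_{t-1}^2(\mathbf{x},\mathbf{z}) = k_{(\mathbf{x},\mathbf{z}),(\mathbf{x},\mathbf{z})} - \mathbf{K}_{(\mathbf{x},\mathbf{z}),\mathcal{D}_{t-1}}(\mathbf{K}_{\mathcal{D}_{t-1}\mathcal{D}_{t-1}}+\sigma_n^2\mathbf{I})^{-1}\mathbf{K}_{\mathcal{D}_{t-1},(\mathbf{x},\mathbf{z})}$, the $\mathbf{K}$'s being matrices of kernel values. Both algorithms use the same $l_{t-1},u_{t-1}$. Algorithms. StableOpt selects $\mathbf{x}_t\in\arg\max_{\mathbf{x}\in\mathcal{D}_{\mathbf{x}}}\min_{\mathbf{z}\in\mathcal{D}_{\mathbf{z}}}u_{t-1}(\mathbf{x},\mathbf{z})$ and $\mathbf{z}_t\in\arg\min_{\mathbf{z}\in\mathcal{D}_{\mathbf{z}}}l_{t-1}(\mathbf{x}_t,\mathbf{z})$. V-UCB at risk level $\alpha$ selects $\mathbf{x}_t\in\arg\max_{\mathbf{x}\in\mathcal{D}_{\mathbf{x}}}V_\alpha(u_{t-1}(\mathbf{x},\mathbf{Z}))$ and $\mathbf{z}_t$ any lacing value with respect to $\mathbf{x}_t$ and $t$, i.e. any $\mathbf{z}\in\mathcal{D}_{\mathbf{z}}$ with $l_{t-1}(\mathbf{x}_t,\mathbf{z})\le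 V_\alpha(l_{t-1}(\mathbf{x}_t,\mathbf{Z}))$ and $u_{t-1}(\mathbf{x}_t,\mathbf{z})\ge V_\alpha(u_{t-1}(\mathbf{x}_t,\mathbf{Z}))$; in the limit $\alpha\to0^+$ each $V_\alpha$ is replaced by $\lim_{\alpha\to0^+}V_\alpha$. *)

theory Defs
  imports "HOL-Probability.Probability" "Jordan_Normal_Form.Gauss_Jordan_Elimination"
begin

no_notation Matrix.vec_index (infixl "$" 100)

definition is_rv_support :: "'a measure \<Rightarrow> ('a \<Rightarrow> 'b::topological_space) \<Rightarrow> 'b set \<Rightarrow> bool" where
  "is_rv_support M Z D \<longleftrightarrow>
     closed D \<and> measure M {a \<in> space M. Z a \<in> D} = 1 \<and>
     (\<forall>C. closed C \<and> measure M {a \<in> space M. Z a \<in> C} = 1 \<longrightarrow> D \<subseteq> C)"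

definition VaR :: "'a measure \<Rightarrow> real \<Rightarrow> ('a \<Rightarrow> real) \<Rightarrow> real" where
  "VaR M \<alpha> Y = Inf {\<omega>. measure M {a \<in> space M. Y a \<le> \<omega>} \<ge> \<alpha>}"

(* As usual for Lim, the value is unspecified if the limit does not exist. *)
definition VaR0 :: "'a measure \<Rightarrow> ('a \<Rightarrow> real) \<Rightarrow> real" where
  "VaR0 M Y = Lim (at_right 0) (\<lambda>\<alpha>. VaR M \<alpha> Y)"

definition argmax_set :: "('b \<Rightarrow> real) \<Rightarrow> 'b set \<Rightarrow> 'b set" where
  "argmax_set g D = {x. is_arg_max g (\<lambda>x. x \<in> D) x}"

definition argmin_set :: "('b \<Rightarrow> real) \<Rightarrow> 'b set \<Rightarrow> 'b set" where
  "argmin_set g D = {x. is_arg_min g (\<lambda>x. x \<in> D) x}"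

(* The minimum over a possibly infinite set; meaningful only when it is attained. *)
definition min_over :: "('b \<Rightarrow> real) \<Rightarrow> 'b set \<Rightarrow> real" where
  "min_over g D = (LEAST m. m \<in> g ` D)"

(* Squared exponential kernel with signal variance s and one lengthscale per coordinate;
   the isotropic kernel is the case of equal lengthscales. *)
definition se_kernel ::
  "real \<Rightarrow> real^'n \<Rightarrow> real^'m \<Rightarrow> (real^'n) \<times> (real^'m) \<Rightarrow> (real^'n) \<times> (real^'m) \<Rightarrow> real" where
  "se_kernel s ax az p q =
     s * exp (- (1 / 2) *
       ((\<Sum>i\<in>UNIV. ((fst p $ i - fst q $ i) / ax $ i)\<^sup>2) +
        (\<Sum>j\<in>UNIV. ((snd p $ j - snd q $ j) / az $ j)\<^sup>2)))"

(* Gaussian process posterior for a symmetric kernel k, noise variance v and a finite, possibly empty,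
   list D of (input, observation) pairs, in which inputs may be repeated. *)

definition gp_cross :: "('p \<Rightarrow> 'p \<Rightarrow> real) \<Rightarrow> ('p \<times> real) list \<Rightarrow> 'p \<Rightarrow> real Matrix.vec" where
  "gp_cross k D p = Matrix.vec (length D) (\<lambda>i. k p (fst (D ! i)))"

definition gp_gram :: "('p \<Rightarrow> 'p \<Rightarrow> real) \<Rightarrow> ('p \<times> real) list \<Rightarrow> real Matrix.mat" where
  "gp_gram k D = Matrix.mat (length D) (length D) (\<lambda>(i, j). k (fst (D ! i)) (fst (D ! j)))"

(* For v > 0 and a positive semidefinite kernel the regularised Gram matrix is positive
   definite, so mat_inverse yields Some. *)
definition gp_inv :: "('p \<Rightarrow> 'p \<Rightarrow> real) \<Rightarrow> real \<Rightarrow> ('p \<times> real) list \<Rightarrow> real Matrix.mat" where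
  "gp_inv k v D = the (mat_inverse (gp_gram k D + v \<cdot>\<^sub>m 1\<^sub>m (length D)))"

definition gp_mean :: "('p \<Rightarrow> 'p \<Rightarrow> real) \<Rightarrow> real \<Rightarrow> ('p \<times> real) list \<Rightarrow> 'p \<Rightarrow> real" where
  "gp_mean k v D p =
     scalar_prod (gp_cross k D p) (gp_inv k v D *\<^sub>v vec_of_list (map snd D))"

definition gp_var :: "('p \<Rightarrow> 'p \<Rightarrow> real) \<Rightarrow> real \<Rightarrow> ('p \<times> real) list \<Rightarrow> 'p \<Rightarrow> real" where
  "gp_var k v D p =
     k p p - scalar_prod (gp_cross k D p) (gp_inv k v D *\<^sub>v gp_cross k D p)"

definition gp_sd :: "('p \<Rightarrow> 'p \<Rightarrow> real) \<Rightarrow> real \<Rightarrow> ('p \<times> real) list \<Rightarrow> 'p \<Rightarrow> real" where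
  "gp_sd k v D p = sqrt (gp_var k v D p)"

definition lower_bound :: "('p \<Rightarrow> 'p \<Rightarrow> real) \<Rightarrow> real \<Rightarrow> ('p \<times> real) list \<Rightarrow> real \<Rightarrow> 'p \<Rightarrow> real" where
  "lower_bound k v D b p = gp_mean k v D p - sqrt b * gp_sd k v D p"

definition upper_bound :: "('p \<Rightarrow> 'p \<Rightarrow> real) \<Rightarrow> real \<Rightarrow> ('p \<times> real) list \<Rightarrow> real \<Rightarrow> 'p \<Rightarrow> real" where
  "upper_bound k v D b p = gp_mean k v D p + sqrt b * gp_sd k v D p"

end

theory Submission
  imports Defs
begin

text \<open>As \<open>\<alpha> \<rightarrow> 0\<^sup>+\<close>, the value-at-risk of \<open>g(Z)\<close> tends to the essential infimum of \<open>g(Z)\<close>.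
  For continuous \<open>g\<close> this is the minimum of \<open>g\<close> over the support of \<open>Z\<close>, since every neighbourhood
  of a support point has positive probability. The confidence bounds are continuous in \<open>z\<close>, so both
  selection rules of V-UCB turn into those of StableOpt; the constraint on \<open>u\<close> in the definition of a
  lacing value becomes \<open>u(x, z) \<ge> min u(x, \<cdot>)\<close> and is void.\<close>

text \<open>The hypotheses make \<open>m\<close> the essential infimum of \<open>Y\<close>. For
  small positive \<alpha>, the set whose infimum is \<open>VaR\<close> is bounded below by
  \<open>m\<close> and contains a point within \<open>e\<close> of it.\<close>

lemma VaR_tendsto:
  fixes Y :: "'a \<Rightarrow> real"
  assumes below: "\<And>\<omega>. \<omega> < m \<Longrightarrow> measure M {a \<in> space M. Y a \<le> \<omega>} = 0"
    and above: "\<And>\<omega>. m < \<omega> \<Longrightarrow> 0 < measure M {a \<in> space M. Y a \<le> \<omega>}"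
  shows "((\<lambda>\<alpha>. VaR M \<alpha> Y) \<longlongrightarrow> m) (at_right 0)"
proof (rule tendstoI)
  fix e :: real assume "0 < e"
  \<comment> \<open>For \<alpha> below \<open>p\<close> the level \<open>m + e / 2\<close> is
    admissible in the definition of \<open>VaR\<close>; halving \<open>e\<close> leaves room for a
    strict inequality.\<close>
  define p where "p = measure M {a \<in> space M. Y a \<le> m + e / 2}"
  have "0 < p"
    unfolding p_def using \<open>0 < e\<close> by (intro above) simp
  have "dist (VaR M \<alpha> Y) m < e" if \<alpha>: "0 < \<alpha>" "\<alpha> < p" for \<alpha>
  proof -
    define S where "S = {\<omega>. \<alpha> \<le> measure M {a \<in> space M. Y a \<le> \<omega>}}"
    have mem: "m + e / 2 \<in> S"
      using \<alpha> by (simp add: S_def p_def)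
    have lb: "m \<le> \<omega>" if "\<omega> \<in> S" for \<omega>
      using that below[of \<omega>] \<alpha> by (force simp: S_def not_le[symmetric])
    have "m \<le> Inf S"
      using mem lb by (intro cInf_greatest) auto
    moreover have "Inf S \<le> m + e / 2"
      using mem lb by (intro cInf_lower bdd_belowI) auto
    ultimately show ?thesis
      using \<open>0 < e\<close> by (simp add: VaR_def S_def dist_real_def)
  qed
  then show "eventually (\<lambda>\<alpha>. dist (VaR M \<alpha> Y) m < e) (at_right 0)"
    using \<open>0 < p\<close> by (auto simp: eventually_at_right_field)
qed

lemma VaR_tendsto_min_on_support:
  fixes Z :: "'a \<Rightarrow> 'b::topological_space" and g :: "'b \<Rightarrow> real"
  assumes "prob_space M" and Z: "Z \<in> borel_measurable M" and supp: "is_rv_support M Z D"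
    and cont: "continuous_on UNIV g" and z0: "is_arg_min g (\<lambda>z. z \<in> D) z0"
  shows "((\<lambda>\<alpha>. VaR M \<alpha> (\<lambda>a. g (Z a))) \<longlongrightarrow> g z0) (at_right 0)"
proof (rule VaR_tendsto)
  interpret prob_space M by fact
  have [measurable]: "Z \<in> borel_measurable M" "g \<in> borel_measurable borel"
    using Z cont by (auto intro: borel_measurable_continuous_onI)
  have "closed D"
    using supp by (simp add: is_rv_support_def)
  then have [measurable]: "D \<in> sets borel"
    by simp
  have "prob {a \<in> space M. Z a \<in> D} = 1"
    using supp by (simp add: is_rv_support_def)
  then have AE_D: "AE a in M. Z a \<in> D"
    by (subst prob_Collect_eq_1[symmetric]) auto
  have z0_D: "z0 \<in> D" and min: "\<And>z. z \<in> D \<Longrightarrow> g z0 \<le> g z"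
    using z0 by (auto simp: is_arg_min_linorder)
  show "measure M {a \<in> space M. g (Z a) \<le> \<omega>} = 0" if "\<omega> < g z0" for \<omega>
  proof -
    have "AE a in M. \<not> g (Z a) \<le> \<omega>"
      using AE_D by eventually_elim (use min that in force)
    then show ?thesis
      by (subst prob_Collect_eq_0) auto
  qed
  show "0 < measure M {a \<in> space M. g (Z a) \<le> \<omega>}" if "g z0 < \<omega>" for \<omega>
  proof (rule ccontr)
    assume "\<not> ?thesis"
    then have "prob {a \<in> space M. g (Z a) \<le> \<omega>} = 0"
      by (simp add: zero_less_measure_iff)
    then have "AE a in M. \<not> g (Z a) \<le> \<omega>"
      by (subst (asm) prob_Collect_eq_0) auto
    \<comment> \<open>The strict inequality is weakened so that the set is closed. Having
      probability one, it then contains the support and hence \<open>z0\<close>, contrary to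
      \<open>g z0 < \<omega>\<close>.\<close>
    then have "AE a in M. Z a \<in> {z. \<omega> \<le> g z}"
      by eventually_elim simp
    then have "prob {a \<in> space M. Z a \<in> {z. \<omega> \<le> g z}} = 1"
      by (subst prob_Collect_eq_1) auto
    moreover have "closed {z. \<omega> \<le> g z}"
      using cont by (intro closed_Collect_le continuous_on_const)
    ultimately have "D \<subseteq> {z. \<omega> \<le> g z}"
      using supp by (simp add: is_rv_support_def)
    then show False
      using z0_D that by auto
  qed
qed

lemma VaR0_eqI:
  assumes "((\<lambda>\<alpha>. VaR M \<alpha> Y) \<longlongrightarrow> m) (at_right 0)"
  shows "VaR0 M Y = m"
  unfolding VaR0_def using assms by (rule tendsto_Lim[rotated]) simp

lemma min_over_eq:
  assumes "is_arg_min g (\<lambda>z. z \<in> D) z0"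
  shows "min_over g D = g z0"
  unfolding min_over_def using assms
  by (intro Least_equality) (auto simp: is_arg_min_linorder)

lemma argmax_set_cong:
  assumes "\<And>x. x \<in> D \<Longrightarrow> g x = h x"
  shows "argmax_set g D = argmax_set h D"
  using assms by (auto simp: argmax_set_def is_arg_max_def)

text \<open>This is the form that the lacing condition on \<open>l\<close> takes once the limit of
  \<open>VaR\<close> is known to be the value at a minimiser.\<close>

lemma argmin_set_eq:
  assumes "is_arg_min g (\<lambda>z. z \<in> D) z0"
  shows "argmin_set g D = {z \<in> D. g z \<le> g z0}"
  using assms by (force simp: argmin_set_def is_arg_min_linorder)

lemma continuous_on_se_kernel:
  "continuous_on UNIV (\<lambda>p. se_kernel s ax az p q)"
  unfolding se_kernel_def divide_inverse by (intro continuous_intros)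

lemma dim_gp_cross: "dim_vec (gp_cross k D p) = length D"
  by (simp add: gp_cross_def)

text \<open>An entry of \<^const>\<open>gp_cross\<close> beyond the dimension is a junk value that does not depend on the point.\<close>

lemma continuous_on_gp_cross:
  fixes k :: "'p::topological_space \<Rightarrow> 'p \<Rightarrow> real"
  assumes "\<And>q. continuous_on UNIV (\<lambda>p. k p q)"
  shows "continuous_on UNIV (\<lambda>p. Matrix.vec_index (gp_cross k D p) i)"
proof (cases "i < length D")
  case True
  then show ?thesis
    using assms by (simp add: gp_cross_def)
next
  case False
  then show ?thesis
    by (simp add: gp_cross_def Matrix.vec.rep_eq Matrix.vec_index.rep_eq mk_vec_def)
qed

text \<open>The vector paired with \<open>gp_cross\<close> does not depend on the point, so the mean
  is a fixed linear combination of entries of \<open>gp_cross\<close>. The sum runs up to the row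
  dimension of \<open>gp_inv\<close>, which is not computed here; indices beyond
  \<open>length D\<close> fall under the junk case of \<open>continuous_on_gp_cross\<close>.\<close>

lemma continuous_on_gp_mean:
  fixes k :: "'p::topological_space \<Rightarrow> 'p \<Rightarrow> real"
  assumes "\<And>q. continuous_on UNIV (\<lambda>p. k p q)"
  shows "continuous_on UNIV (gp_mean k v D)"
  unfolding gp_mean_def[abs_def] scalar_prod_def
  by (intro continuous_intros continuous_on_gp_cross assms)

lemma continuous_on_gp_var:
  fixes k :: "'p::topological_space \<Rightarrow> 'p \<Rightarrow> real"
  assumes "\<And>q. continuous_on UNIV (\<lambda>p. k p q)" and "continuous_on UNIV (\<lambda>p. k p p)"
  shows "continuous_on UNIV (gp_var k v D)"
proof -
  \<comment> \<open>A quadratic form with an arbitrary fixed matrix \<open>A\<close> in place of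
    \<open>gp_inv\<close> is continuous: its index ranges \<open>dim_row A\<close> and
    \<open>length D\<close> do not depend on \<open>p\<close>.\<close>
  have "continuous_on UNIV (\<lambda>p. scalar_prod (gp_cross k D p) (A *\<^sub>v gp_cross k D p))" for A
  proof -
    have "scalar_prod (gp_cross k D p) (A *\<^sub>v gp_cross k D p) =
      (\<Sum>i<dim_row A. Matrix.vec_index (gp_cross k D p) i *
        (\<Sum>j<length D. Matrix.vec_index (row A i) j * Matrix.vec_index (gp_cross k D p) j))" for p
      by (simp add: scalar_prod_def atLeast0LessThan dim_gp_cross)
    then show ?thesis
      by (simp only:) (intro continuous_intros continuous_on_gp_cross assms)
  qed
  then show ?thesis
    unfolding gp_var_def[abs_def] by (intro continuous_intros assms)
qed

text \<open>The HOL function \<open>sqrt\<close> is continuous on all reals, negative ones included,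
  so continuity passes from \<open>gp_var\<close> to \<open>gp_sd\<close> whatever the sign of the
  variance.\<close>

lemma continuous_on_se_bounds:
  "continuous_on UNIV (lower_bound (se_kernel s ax az) v D b)"
  "continuous_on UNIV (upper_bound (se_kernel s ax az) v D b)"
proof -
  \<comment> \<open>On the diagonal all differences vanish and the kernel is the constant
    \<open>s\<close>.\<close>
  have diag: "continuous_on UNIV (\<lambda>p. se_kernel s ax az p p)"
    unfolding se_kernel_def by simp
  show "continuous_on UNIV (lower_bound (se_kernel s ax az) v D b)"
    "continuous_on UNIV (upper_bound (se_kernel s ax az) v D b)"
    unfolding lower_bound_def[abs_def] upper_bound_def[abs_def] gp_sd_def
    by (intro continuous_intros continuous_on_gp_mean continuous_on_gp_var
        continuous_on_se_kernel diag)+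
qed

theorem corollary2p2:
  fixes M :: "'a measure"
    and Z :: "'a \<Rightarrow> real^'dz"
    and Dx :: "(real^'dx) set"
    and Dz :: "(real^'dz) set"
    and s noise :: real
    and ax :: "real^'dx"
    and az :: "real^'dz"
    and \<beta> :: "nat \<Rightarrow> real"
    and obs :: "nat \<Rightarrow> (((real^'dx) \<times> (real^'dz)) \<times> real) list"
    and t :: nat
    and l u :: "real^'dx \<Rightarrow> real^'dz \<Rightarrow> real"
  assumes "prob_space M"
    and "Z \<in> borel_measurable M"
    and "is_rv_support M Z Dz"
    and "bounded Dx"
    and "s > 0" and "\<forall>i. ax $ i > 0" and "\<forall>j. az $ j > 0"
    and "noise > 0"
    and "t \<ge> 1"
    and "\<beta> t \<ge> 0"
    and "fst ` set (obs (t - 1)) \<subseteq> Dx \<times> Dz"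
    and l_def: "l = (\<lambda>x z. lower_bound (se_kernel s ax az) noise (obs (t - 1)) (\<beta> t) (x, z))"
    and u_def: "u = (\<lambda>x z. upper_bound (se_kernel s ax az) noise (obs (t - 1)) (\<beta> t) (x, z))"
    and "\<forall>x\<in>Dx. \<exists>z. is_arg_min (u x) (\<lambda>z. z \<in> Dz) z"
    and "\<forall>x\<in>Dx. \<exists>z. is_arg_min (l x) (\<lambda>z. z \<in> Dz) z"
  shows "(\<forall>x\<in>Dx.
            ((\<lambda>\<alpha>. VaR M \<alpha> (\<lambda>a. u x (Z a))) \<longlongrightarrow> VaR0 M (\<lambda>a. u x (Z a))) (at_right 0) \<and>
            ((\<lambda>\<alpha>. VaR M \<alpha> (\<lambda>a. l x (Z a))) \<longlongrightarrow> VaR0 M (\<lambda>a. l x (Z a))) (at_right 0)) \<and>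
         argmax_set (\<lambda>x. VaR0 M (\<lambda>a. u x (Z a))) Dx = argmax_set (\<lambda>x. min_over (u x) Dz) Dx \<and>
         (\<forall>xt \<in> argmax_set (\<lambda>x. VaR0 M (\<lambda>a. u x (Z a))) Dx.
            {z \<in> Dz. l xt z \<le> VaR0 M (\<lambda>a. l xt (Z a)) \<and> u xt z \<ge> VaR0 M (\<lambda>a. u xt (Z a))}
              = argmin_set (l xt) Dz)"
proof -
  let ?U = "\<lambda>x. VaR0 M (\<lambda>a. u x (Z a))" and ?L = "\<lambda>x. VaR0 M (\<lambda>a. l x (Z a))"
  \<comment> \<open>Joint continuity is restricted to the slice
    \<open>z \<mapsto> (x, z)\<close>.\<close>
  have cont: "continuous_on UNIV (l x)" "continuous_on UNIV (u x)" for x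
    unfolding l_def u_def
    by (intro continuous_on_compose2[OF continuous_on_se_bounds(1)]
        continuous_on_compose2[OF continuous_on_se_bounds(2)] continuous_intros; simp)+
  note lim = VaR_tendsto_min_on_support[OF assms(1-3)]
  obtain zu where zu: "\<And>x. x \<in> Dx \<Longrightarrow> is_arg_min (u x) (\<lambda>z. z \<in> Dz) (zu x)"
    using assms(14) by metis
  obtain zl where zl: "\<And>x. x \<in> Dx \<Longrightarrow> is_arg_min (l x) (\<lambda>z. z \<in> Dz) (zl x)"
    using assms(15) by metis
  \<comment> \<open>Convergence is established first, so that the \<open>Lim\<close> inside
    \<open>VaR0\<close> is a genuine limit and can be evaluated.\<close>
  have limU: "((\<lambda>\<alpha>. VaR M \<alpha> (\<lambda>a. u x (Z a))) \<longlongrightarrow> u x (zu x)) (at_right 0)"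
    and limL: "((\<lambda>\<alpha>. VaR M \<alpha> (\<lambda>a. l x (Z a))) \<longlongrightarrow> l x (zl x)) (at_right 0)"
    if "x \<in> Dx" for x
    using lim[OF cont(2) zu[OF that]] lim[OF cont(1) zl[OF that]] .
  have U: "?U x = u x (zu x)" and L: "?L x = l x (zl x)" if "x \<in> Dx" for x
    using limU[OF that] limL[OF that] by (simp_all add: VaR0_eqI)
  have "argmax_set ?U Dx = argmax_set (\<lambda>x. min_over (u x) Dz) Dx"
    by (rule argmax_set_cong) (simp add: U min_over_eq[OF zu])
  \<comment> \<open>Minimality of \<open>zu x\<close> gives the inequality on \<open>u\<close> for
    every \<open>z\<close> in \<open>Dz\<close>; what remains is the sublevel set of
    \<open>l x\<close> at its minimum.\<close>
  moreover have "{z \<in> Dz. l x z \<le> ?L x \<and> u x z \<ge> ?U x} = argmin_set (l x) Dz" if "x \<in> Dx" for x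
    using zu[OF that] by (auto simp: U L that argmin_set_eq[OF zl[OF that]] is_arg_min_linorder)
  moreover have "x \<in> Dx" if "x \<in> argmax_set ?U Dx" for x
    using that by (simp add: argmax_set_def is_arg_max_def)
  ultimately show ?thesis
    using limU limL U L by simp
qed

end
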